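(* Let $A\in\mathcal{S}^n$ be a symmetric matrix with nonnegative entries and with $A_{ii}>0$ for all $i\in[n]$. Let $$\tau_{\mathrm{cp}}(A)=\inf\Big\{\lambda:\ \tfrac1\lambda A\in\mathrm{conv}\{xx^T:\ x\in\mathbb{R}^n_+,\ A-xx^T\succeq0,\ A\ge xx^T\}\Big\}.$$ Then $\tau_{\mathrm{cp}}(A)$ is equal to the optimal value of the generalized moment problem $$\mathrm{val}_{\mathrm{cp}}=\inf_{\mu\in\mathscr{M}(\mathbb{R}^n)}\Big\{\int1\,d\mu:\ \int x_ix_j\,d\mu=A_{ij}\ (i,j\in[n]),\ \mathrm{Supp}(\mu)\subseteq K_A\Big\},$$ where $$K_A=\{x\in\mathbb{R}^n:\ \sqrt{A_{ii}}\,x_i-x_i^2\ge0\ (i\in[n]),\ A_{ij}-x_ix_j\ge0\ (\{i,j\}\in E_A),\ x_ix_j=0\ (\{i,j\}\in\overline{E}_A),\ A-xx^T\succeq0\}.$$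
   Context: $\mathcal{S}^n$ is the set of real symmetric $n\times n$ matrices; $M\succeq0$ means positive semidefinite, and $A\ge xx^T$ is meant entrywise. In the definition of $\tau_{\mathrm{cp}}$, $\lambda$ ranges over positive reals. $E_A=\{\{i,j\}:\ i\ne j\in[n],\ A_{ij}\ne0\}$ and $\overline{E}_A=\{\{i,j\}:\ i\ne j\in[n],\ A_{ij}=0\}$. $\mathscr{M}(\mathbb{R}^n)$ is the set of finite positive Borel measures on $\mathbb{R}^n$, and $\mathrm{Supp}(\mu)\subseteq K_A$ means $\mu(\mathbb{R}^n\setminus K_A)=0$. The infimum over the empty set is $+\infty$ (both values equal $+\infty$ when infeasible). *)

theory Defs
  imports "HOL-Analysis.Analysis"
begin

definition psd :: "real^'n^'n \<Rightarrow> bool" where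
  "psd M \<longleftrightarrow> transpose M = M \<and> (\<forall>v. 0 \<le> v \<bullet> (M *v v))"

definition outer_square :: "real^'n \<Rightarrow> real^'n^'n" where
  "outer_square x = (\<chi> i j. x $ i * x $ j)"

definition cp_atoms :: "real^'n^'n \<Rightarrow> (real^'n^'n) set" where
  "cp_atoms A = {outer_square x | x.
     (\<forall>i. 0 \<le> x $ i) \<and> psd (A - outer_square x) \<and>
     (\<forall>i j. outer_square x $ i $ j \<le> A $ i $ j)}"

text \<open>Both optimal values are extended reals, so that the infimum of the empty set is \<open>\<infinity>\<close>.\<close>

definition tau_cp :: "real^'n^'n \<Rightarrow> ereal" where
  "tau_cp A = Inf {ereal l | l. 0 < l \<and> (1 / l) *\<^sub>R A \<in> convex hull (cp_atoms A)}"

definition edges :: "real^'n^'n \<Rightarrow> 'n set set" where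
  "edges A = {{i, j} | i j. i \<noteq> j \<and> A $ i $ j \<noteq> 0}"

definition non_edges :: "real^'n^'n \<Rightarrow> 'n set set" where
  "non_edges A = {{i, j} | i j. i \<noteq> j \<and> A $ i $ j = 0}"

definition K_cp :: "real^'n^'n \<Rightarrow> (real^'n) set" where
  "K_cp A = {x.
     (\<forall>i. 0 \<le> sqrt (A $ i $ i) * x $ i - (x $ i)\<^sup>2) \<and>
     (\<forall>i j. {i, j} \<in> edges A \<longrightarrow> 0 \<le> A $ i $ j - x $ i * x $ j) \<and>
     (\<forall>i j. {i, j} \<in> non_edges A \<longrightarrow> x $ i * x $ j = 0) \<and>
     psd (A - outer_square x)}"

text \<open>
  The predicate \<open>has_bochner_integral\<close> states integrability of the monomials together with the
  value of the integral, so the default value of a non-existing integral plays no role.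
  Likewise membership in \<open>null_sets\<close> includes measurability of the complement of \<open>K_cp A\<close>
  (which holds because \<open>K_cp A\<close> is closed).
\<close>

definition cp_feasible :: "real^'n^'n \<Rightarrow> (real^'n) measure \<Rightarrow> bool" where
  "cp_feasible A \<mu> \<longleftrightarrow>
     sets \<mu> = sets borel \<and> finite_measure \<mu> \<and>
     (\<forall>i j. has_bochner_integral \<mu> (\<lambda>x. x $ i * x $ j) (A $ i $ j)) \<and>
     UNIV - K_cp A \<in> null_sets \<mu>"

definition val_cp :: "real^'n^'n \<Rightarrow> ereal" where
  "val_cp A = Inf {ereal (\<integral>x. 1 \<partial>\<mu>) | \<mu>. cp_feasible A \<mu>}"

end

theory Submission
  imports Defs
begin

text \<open>
  The two optimal values agree because the two sets of admissible values are the same.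

  The polynomial constraints of \<open>K_cp A\<close> describe the vectors behind the atoms:
  \<open>\<surd>A\<^sub>i\<^sub>i x\<^sub>i - x\<^sub>i\<^sup>2 \<ge> 0\<close> says \<open>0 \<le> x\<^sub>i \<le> \<surd>A\<^sub>i\<^sub>i\<close>, and for nonnegative \<open>x\<close>
  a zero entry \<open>A\<^sub>i\<^sub>j\<close> forces \<open>x\<^sub>i x\<^sub>j = 0\<close>. Hence \<open>cp_atoms A\<close> is the image of
  \<open>K_cp A\<close> under \<open>x \<mapsto> x x\<^sup>T\<close> (\<open>cp_atoms_eq_image_K_cp\<close>). Since \<open>K_cp A\<close> is compact, so is
  the convex hull of the atoms.

  A representation of \<open>A / l\<close> as a convex combination of atoms is the same thing as a finitely
  supported representing measure of mass \<open>l\<close> on \<open>K_cp A\<close>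
  (\<open>cp_feasible_of_convex_combination\<close>). Conversely, a feasible measure \<open>\<mu>\<close> of mass \<open>l\<close>
  exhibits \<open>A / l\<close> as the mean of \<open>x x\<^sup>T\<close> under \<open>\<mu> / l\<close>, and the mean of a function with
  values in a closed convex set stays in that set (\<open>mean_in_closed_convex\<close>). The mass is
  positive because \<open>A\<close> is not zero.
\<close>

section \<open>The atoms as the image of a compact set\<close>

lemma outer_square_nth [simp]: "outer_square x $ i $ j = x $ i * x $ j"
  by (simp add: outer_square_def)

lemma continuous_on_outer_square: "continuous_on S outer_square"
  unfolding outer_square_def by (intro continuous_intros continuous_on_vec_lambda)

lemma psd_diff_outer_square_iff:
  assumes "transpose A = A"
  shows "psd (A - outer_square x) \<longleftrightarrow> (\<forall>v. 0 \<le> v \<bullet> ((A - outer_square x) *v v))"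
proof -
  have "A $ i $ j = A $ j $ i" for i j
    using assms by (metis transpose_def vec_lambda_beta)
  then have "transpose (A - outer_square x) = A - outer_square x"
    by (simp add: vec_eq_iff transpose_def mult.commute)
  then show ?thesis by (simp add: psd_def)
qed

text \<open>
  The support constraints distinguish diagonal, edge and non-edge positions. For nonnegative \<open>x\<close>
  they collapse into the single entrywise bound used for the atoms: at a non-edge,
  \<open>0 \<le> x\<^sub>i x\<^sub>j \<le> 0\<close> is the same as \<open>x\<^sub>i x\<^sub>j = 0\<close>. Nonnegativity itself
  comes from the diagonal constraint, because \<open>x\<^sub>i\<close> and \<open>\<surd>A\<^sub>i\<^sub>i - x\<^sub>i\<close> cannot
  both be negative when \<open>A\<^sub>i\<^sub>i > 0\<close>.
\<close>

lemma K_cp_iff: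
  assumes "transpose A = A" and nonneg: "\<And>i j. 0 \<le> A $ i $ j" and pos: "\<And>i. 0 < A $ i $ i"
  shows "x \<in> K_cp A \<longleftrightarrow> (\<forall>i. 0 \<le> x $ i) \<and> psd (A - outer_square x) \<and>
           (\<forall>i j. x $ i * x $ j \<le> A $ i $ j)"
proof -
  have sym: "A $ i $ j = A $ j $ i" for i j
    using assms(1) by (metis transpose_def vec_lambda_beta)
  have diag: "0 \<le> sqrt (A $ i $ i) * x $ i - (x $ i)\<^sup>2 \<longleftrightarrow> 0 \<le> x $ i \<and> x $ i * x $ i \<le> A $ i $ i"
    for i
  proof -
    let ?s = "sqrt (A $ i $ i)"
    have s: "0 < ?s" using pos by simp
    have "0 \<le> ?s * x $ i - (x $ i)\<^sup>2 \<longleftrightarrow> 0 \<le> x $ i * (?s - x $ i)"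
      by (simp add: algebra_simps power2_eq_square)
    also have "\<dots> \<longleftrightarrow> 0 \<le> x $ i \<and> x $ i \<le> ?s"
      using s unfolding zero_le_mult_iff by (smt (verit))
    also have "\<dots> \<longleftrightarrow> 0 \<le> x $ i \<and> x $ i * x $ i \<le> A $ i $ i"
      using real_le_rsqrt[of "x $ i"] sqrt_ge_absD[of "x $ i"]
      by (auto simp: power2_eq_square)
    finally show ?thesis .
  qed
  \<comment> \<open>Edges are unordered pairs; symmetry makes membership independent of the chosen ordering.\<close>
  have edge: "{i, j} \<in> edges A \<longleftrightarrow> i \<noteq> j \<and> A $ i $ j \<noteq> 0" for i j
    using sym[of i j] by (auto simp: edges_def doubleton_eq_iff)
  have non_edge: "{i, j} \<in> non_edges A \<longleftrightarrow> i \<noteq> j \<and> A $ i $ j = 0" for i j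
    using sym[of i j] by (auto simp: non_edges_def doubleton_eq_iff)
  have off_diag: "(i \<noteq> j \<and> A $ i $ j \<noteq> 0 \<longrightarrow> 0 \<le> A $ i $ j - x $ i * x $ j) \<and>
      (i \<noteq> j \<and> A $ i $ j = 0 \<longrightarrow> x $ i * x $ j = 0) \<longleftrightarrow>
      (i \<noteq> j \<longrightarrow> x $ i * x $ j \<le> A $ i $ j)" if "\<forall>i. 0 \<le> x $ i" for i j
  proof -
    have "0 \<le> x $ i * x $ j" using that by simp
    then show ?thesis by auto
  qed
  show ?thesis
  proof (cases "\<forall>i. 0 \<le> x $ i")
    case True
    have "x \<in> K_cp A \<longleftrightarrow> (\<forall>i. 0 \<le> x $ i \<and> x $ i * x $ i \<le> A $ i $ i) \<and>
        (\<forall>i j. (i \<noteq> j \<and> A $ i $ j \<noteq> 0 \<longrightarrow> 0 \<le> A $ i $ j - x $ i * x $ j) \<and>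
          (i \<noteq> j \<and> A $ i $ j = 0 \<longrightarrow> x $ i * x $ j = 0)) \<and> psd (A - outer_square x)"
      unfolding K_cp_def mem_Collect_eq diag edge non_edge by (simp only: all_conj_distrib conj_assoc)
    also have "\<dots> \<longleftrightarrow> (\<forall>i. 0 \<le> x $ i \<and> x $ i * x $ i \<le> A $ i $ i) \<and>
        (\<forall>i j. i \<noteq> j \<longrightarrow> x $ i * x $ j \<le> A $ i $ j) \<and> psd (A - outer_square x)"
      unfolding off_diag[OF True] ..
    also have "\<dots> \<longleftrightarrow> (\<forall>i. 0 \<le> x $ i) \<and> psd (A - outer_square x) \<and>
        (\<forall>i j. x $ i * x $ j \<le> A $ i $ j)"
      by metis
    finally show ?thesis .
  next
    case False
    then show ?thesis unfolding K_cp_def mem_Collect_eq diag by blast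
  qed
qed

lemma cp_atoms_eq_image_K_cp:
  assumes "transpose A = A" and "\<And>i j. 0 \<le> A $ i $ j" and "\<And>i. 0 < A $ i $ i"
  shows "cp_atoms A = outer_square ` K_cp A"
  unfolding cp_atoms_def using K_cp_iff[OF assms] by auto

lemma compact_K_cp:
  assumes "transpose A = A" and "\<And>i j. 0 \<le> A $ i $ j" and "\<And>i. 0 < A $ i $ i"
  shows "compact (K_cp A)"
proof -
  have "K_cp A = {x. (\<forall>i. 0 \<le> x $ i) \<and> (\<forall>v. 0 \<le> v \<bullet> ((A - outer_square x) *v v)) \<and>
      (\<forall>i j. x $ i * x $ j \<le> A $ i $ j)}"
    using K_cp_iff[OF assms] psd_diff_outer_square_iff[OF assms(1)] by auto
  also have "closed \<dots>"
    unfolding inner_vec_def matrix_vector_mult_def vector_minus_component outer_square_nth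
      vec_lambda_beta inner_real_def
    by (intro closed_Collect_conj closed_Collect_all closed_Collect_le continuous_intros)
  finally have "closed (K_cp A)" .
  moreover have "K_cp A \<subseteq> cbox 0 (\<chi> i. sqrt (A $ i $ i))"
    using K_cp_iff[OF assms]
    by (auto simp: mem_box_cart power2_eq_square intro!: real_le_rsqrt)
  ultimately show ?thesis
    using bounded_cbox bounded_subset compact_eq_bounded_closed by blast
qed

section \<open>From measures to convex combinations\<close>

text \<open>
  A point outside a closed convex set is strictly separated from it by a linear functional.
  Integration preserves the inequality that the functional satisfies on the set, so the mean
  cannot be such a point.
\<close>

lemma mean_in_closed_convex:
  fixes f :: "'a \<Rightarrow> 'b::euclidean_space"
  assumes "finite_measure M" and "convex C" and "closed C"
    and int: "has_bochner_integral M f I" and AE: "AE x in M. f x \<in> C"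
    and pos: "0 < measure M (space M)"
  shows "(1 / measure M (space M)) *\<^sub>R I \<in> C"
proof (rule ccontr)
  interpret finite_measure M by fact
  let ?m = "measure M (space M)"
  assume "(1 / ?m) *\<^sub>R I \<notin> C"
  then obtain a b where below: "a \<bullet> ((1 / ?m) *\<^sub>R I) < b" and above: "\<forall>c\<in>C. a \<bullet> c > b"
    using separating_hyperplane_closed_point assms(2,3) by blast
  have inner_int: "has_bochner_integral M (\<lambda>x. a \<bullet> f x) (a \<bullet> I)"
    using int by (rule has_bochner_integral_inner_right)
  have "b * ?m = (\<integral>x. b \<partial>M)"
    by simp
  also have "\<dots> \<le> (\<integral>x. a \<bullet> f x \<partial>M)"
    using inner_int AE above
    by (intro integral_mono_AE) (auto simp: has_bochner_integral_iff less_imp_le elim!: eventually_mono)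
  also have "\<dots> = a \<bullet> I"
    using inner_int by (simp add: has_bochner_integral_iff)
  finally show False
    using below pos by (simp add: field_simps)
qed

lemma has_bochner_integral_matrix:
  fixes f :: "'a \<Rightarrow> real^'m^'n"
  assumes "\<And>i j. has_bochner_integral M (\<lambda>x. f x $ i $ j) (B $ i $ j)"
  shows "has_bochner_integral M f B"
proof -
  have expand: "(\<Sum>i\<in>UNIV. \<Sum>j\<in>UNIV. (C $ i $ j) *\<^sub>R axis i (axis j 1)) = C" for C :: "real^'m^'n"
  proof -
    have "(\<Sum>j\<in>UNIV. ((C $ i $ j) *\<^sub>R axis i (axis j 1)) $ k $ m) = (if i = k then C $ i $ m else 0)"
      for i k m
    proof -
      have "((C $ i $ j) *\<^sub>R axis i (axis j 1)) $ k $ m =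
          (if j = m then if i = k then C $ i $ m else 0 else 0)" for j
        by (simp add: axis_def)
      then show ?thesis by simp
    qed
    then show ?thesis by (simp add: vec_eq_iff)
  qed
  have "has_bochner_integral M
      (\<lambda>x. \<Sum>i\<in>UNIV. \<Sum>j\<in>UNIV. (f x $ i $ j) *\<^sub>R axis i (axis j (1::real)))
      (\<Sum>i\<in>UNIV. \<Sum>j\<in>UNIV. (B $ i $ j) *\<^sub>R axis i (axis j (1::real)))"
    by (intro has_bochner_integral_sum has_bochner_integral_scaleR_left assms)
  then show ?thesis by (simp add: expand)
qed

lemma convex_combination_of_cp_feasible:
  assumes A: "transpose A = A" "\<And>i j. 0 \<le> A $ i $ j" "\<And>i. 0 < A $ i $ i"
    and feas: "cp_feasible A \<mu>"
  defines "l \<equiv> measure \<mu> (space \<mu>)"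
  shows "0 < l" and "(1 / l) *\<^sub>R A \<in> convex hull (cp_atoms A)"
proof -
  interpret finite_measure \<mu> using feas by (simp add: cp_feasible_def)
  have moments: "has_bochner_integral \<mu> (\<lambda>x. x $ i * x $ j) (A $ i $ j)" for i j
    using feas by (simp add: cp_feasible_def)
  have "l \<noteq> 0"
  proof
    assume "l = 0"
    then have "emeasure \<mu> (space \<mu>) = 0"
      by (simp add: l_def emeasure_eq_measure)
    then have "AE x in \<mu>. x $ i * x $ i = 0" for i
      by (intro AE_I[of _ _ "space \<mu>"]) auto
    then have "(\<integral>x. x $ i * x $ i \<partial>\<mu>) = 0" for i
      by (rule integral_eq_zero_AE)
    then show False
      using moments A(3) by (metis has_bochner_integral_integral_eq less_irrefl)
  qed
  then show "0 < l"
    by (simp add: l_def zero_less_measure_iff measure_eq_0_null_sets)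
  have "compact (convex hull (cp_atoms A))"
    using compact_convex_hull compact_continuous_image[OF continuous_on_outer_square compact_K_cp[OF A]]
    by (metis cp_atoms_eq_image_K_cp[OF A])
  then have "closed (convex hull (cp_atoms A))"
    by (rule compact_imp_closed)
  moreover have "AE x in \<mu>. outer_square x \<in> convex hull (cp_atoms A)"
  proof -
    have "AE x in \<mu>. x \<notin> UNIV - K_cp A"
      using feas by (intro AE_not_in) (simp add: cp_feasible_def)
    then show ?thesis
      by (rule eventually_mono) (auto simp: cp_atoms_eq_image_K_cp[OF A] intro: hull_inc)
  qed
  moreover have "has_bochner_integral \<mu> outer_square A"
    using moments by (intro has_bochner_integral_matrix) simp
  ultimately show "(1 / l) *\<^sub>R A \<in> convex hull (cp_atoms A)"
    unfolding l_def using \<open>0 < l\<close>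
    by (intro mean_in_closed_convex) (auto simp: l_def finite_measure_axioms)
qed

section \<open>From convex combinations to measures\<close>

text \<open>
  A convex combination of atoms with coefficients \<open>u\<close> becomes a sum of point masses
  \<open>l * u v\<close>, each placed at a vector of \<open>K_cp A\<close> that represents the atom \<open>v\<close>. It is obtained as
  the image of a weighted counting measure on the finite set of atoms.
\<close>

lemma cp_feasible_of_convex_combination:
  fixes A :: "real^'n^'n"
  assumes A: "transpose A = A" "\<And>i j. 0 \<le> A $ i $ j" "\<And>i. 0 < A $ i $ i"
    and l: "0 < l" and mem: "(1 / l) *\<^sub>R A \<in> convex hull (cp_atoms A)"
  obtains \<mu> where "cp_feasible A \<mu>" and "measure \<mu> (space \<mu>) = l"
proof -
  obtain S u where S: "finite S" "S \<subseteq> cp_atoms A" and u: "\<forall>v\<in>S. 0 \<le> u v" "sum u S = 1"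
    and comb: "(\<Sum>v\<in>S. u v *\<^sub>R v) = (1 / l) *\<^sub>R A"
    using mem unfolding convex_hull_explicit mem_Collect_eq by (elim exE conjE) (rule that)
  have "\<forall>v\<in>S. \<exists>x. x \<in> K_cp A \<and> v = outer_square x"
    using S(2) unfolding cp_atoms_eq_image_K_cp[OF A] by auto
  then obtain g where g: "\<forall>v\<in>S. g v \<in> K_cp A \<and> v = outer_square (g v)"
    by metis
  define w where "w v = l * u v" for v
  have w: "\<And>v. v \<in> S \<Longrightarrow> 0 \<le> w v" using u l by (simp add: w_def)
  define N where "N = point_measure S w"
  define \<mu> where "\<mu> = distr N borel g"
  have g_meas [measurable]: "g \<in> measurable N borel"
    by (simp add: N_def)
  have mass: "emeasure \<mu> UNIV = ennreal l"
  proof -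
    have "emeasure \<mu> UNIV = emeasure N S"
      by (simp add: \<mu>_def emeasure_distr) (simp add: N_def space_point_measure)
    also have "\<dots> = (\<Sum>v\<in>S. ennreal (w v))"
      using S(1) by (simp add: N_def emeasure_point_measure_finite)
    also have "\<dots> = ennreal (\<Sum>v\<in>S. w v)"
      using w by simp
    also have "(\<Sum>v\<in>S. w v) = l"
      using u(2) by (simp add: w_def flip: sum_distrib_left)
    finally show ?thesis .
  qed
  have "finite_measure \<mu>"
    using mass by (intro finite_measureI) (simp add: \<mu>_def)
  moreover have "has_bochner_integral \<mu> (\<lambda>x. x $ i * x $ j) (A $ i $ j)" for i j
  proof -
    have meas: "(\<lambda>x::real^'n. x $ i * x $ j) \<in> borel_measurable borel"
      by (intro borel_measurable_continuous_onI continuous_intros)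
    have "integrable N (\<lambda>v. g v $ i * g v $ j)"
      using S(1) by (simp add: N_def integrable_point_measure_finite)
    moreover have "(\<integral>v. g v $ i * g v $ j \<partial>N) = (\<Sum>v\<in>S. w v * (g v $ i * g v $ j))"
      using S(1) w by (simp add: N_def lebesgue_integral_point_measure_finite)
    moreover have "\<dots> = A $ i $ j"
    proof -
      have "(\<Sum>v\<in>S. w v * (g v $ i * g v $ j)) = (\<Sum>v\<in>S. l * (u v * v $ i $ j))"
        by (rule sum.cong) (use g in \<open>auto simp: w_def simp flip: outer_square_nth\<close>)
      also have "\<dots> = l * (\<Sum>v\<in>S. u v *\<^sub>R v) $ i $ j"
        by (simp add: sum_distrib_left)
      finally show ?thesis
        using comb l by simp
    qed
    ultimately show ?thesis
      using meas by (simp add: has_bochner_integral_iff \<mu>_def integrable_distr_eq integral_distr)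
  qed
  moreover have "UNIV - K_cp A \<in> null_sets \<mu>"
  proof -
    have "UNIV - K_cp A \<in> sets borel"
      using compact_imp_closed[OF compact_K_cp[OF A]] by auto
    moreover have "g -` (UNIV - K_cp A) \<inter> S = {}"
      using g by auto
    ultimately show ?thesis
      by (simp add: null_sets_def \<mu>_def emeasure_distr N_def space_point_measure)
  qed
  ultimately have "cp_feasible A \<mu>"
    by (simp add: cp_feasible_def \<mu>_def)
  moreover have "measure \<mu> (space \<mu>) = l"
    using mass l by (simp add: \<mu>_def measure_def)
  ultimately show ?thesis by (rule that)
qed

section \<open>Equality of the optimal values\<close>

theorem lemma2:
  fixes A :: "real^'n^'n"
  assumes "transpose A = A"
    and "\<And>i j. 0 \<le> A $ i $ j"
    and "\<And>i. 0 < A $ i $ i"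
  shows "tau_cp A = val_cp A"
proof -
  have "{ereal l | l. 0 < l \<and> (1 / l) *\<^sub>R A \<in> convex hull (cp_atoms A)}
      = {ereal (\<integral>x. 1 \<partial>\<mu>) | \<mu>. cp_feasible A \<mu>}" (is "?L = ?R")
  proof
    show "?L \<subseteq> ?R"
    proof
      fix e assume "e \<in> ?L"
      then obtain l where "e = ereal l" "0 < l" "(1 / l) *\<^sub>R A \<in> convex hull (cp_atoms A)"
        by blast
      then obtain \<mu> where "cp_feasible A \<mu>" "e = ereal (measure \<mu> (space \<mu>))"
        using cp_feasible_of_convex_combination[OF assms] by metis
      then show "e \<in> ?R" by auto
    qed
    show "?R \<subseteq> ?L"
      using convex_combination_of_cp_feasible[OF assms] by auto
  qed
  then show ?thesis by (simp add: tau_cp_def val_cp_def)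
qed

end
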